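(* For every $x,y\in\mathbb{A}^{1,\mathrm{an}}_k$, there exists a unique injective path from $x$ to $y$ in $\mathbb{A}^{1,\mathrm{an}}_k$.
   Context: $(k,|\cdot|)$ is a complete non-Archimedean valued field. The Berkovich affine line $\mathbb{A}^{1,\mathrm{an}}_k$ is the set of multiplicative seminorms $|\cdot|_x$ on $k[T]$ inducing the given absolute value on $k$, with the coarsest topology making all maps $x\mapsto|P|_x$ ($P\in k[T]$) continuous. Injective paths are considered up to reparametrization (i.e. identified with their images); for $x=y$ the path is the constant one. *)

theory Defs
  imports "HOL-Analysis.Analysis" "HOL-Computational_Algebra.Polynomial"
begin

text \<open>The trivial absolute value is allowed.\<close>

locale nonarch_valued_field =
  fixes v :: "'k::field \<Rightarrow> real"
  assumes nonneg: "0 \<le> v a"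
    and eq_0_iff: "v a = 0 \<longleftrightarrow> a = 0"
    and mult: "v (a * b) = v a * v b"
    and ultrametric: "v (a + b) \<le> max (v a) (v b)"
begin

lemma v_uminus: "v (- a) = v a"
proof -
  have "v 1 = v 1 * v 1" using mult[of 1 1] by simp
  then have "v 1 = 1" using eq_0_iff[of 1] by simp
  moreover have "v (-1) * v (-1) = v 1" using mult[of "-1" "-1"] by simp
  ultimately have "v (-1) = 1" 
    using nonneg[of "-1"] by (metis abs_of_nonneg abs_1 real_sqrt_abs2 real_sqrt_one)
  then show ?thesis using mult[of "-1" a] by simp
qed

sublocale Metric_space UNIV "\<lambda>a b. v (a - b)"
proof
  fix a b c :: 'k
  show "0 \<le> v (a - b)" by (rule nonneg)
  show "v (a - b) = v (b - a)" using v_uminus[of "a - b"] by simp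
  show "(v (a - b) = 0) = (a = b)" by (simp add: eq_0_iff)
  have "v (a - c) \<le> max (v (a - b)) (v (b - c))"
    using ultrametric[of "a - b" "b - c"] by simp
  then show "v (a - c) \<le> v (a - b) + v (b - c)"
    using nonneg[of "a - b"] nonneg[of "b - c"] by linarith
qed

end

locale complete_nonarch_valued_field = nonarch_valued_field +
  assumes complete: mcomplete

definition mult_seminorm :: "('r::comm_ring_1 \<Rightarrow> real) \<Rightarrow> bool" where
  "mult_seminorm s \<longleftrightarrow>
     (\<forall>f. 0 \<le> s f) \<and> s 0 = 0 \<and> s 1 = 1 \<and>
     (\<forall>f g. s (f + g) \<le> s f + s g) \<and>
     (\<forall>f g. s (f * g) = s f * s g)"

definition berkovich_line :: "('k::field \<Rightarrow> real) \<Rightarrow> ('k poly \<Rightarrow> real) set" where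
  "berkovich_line v = {x. mult_seminorm x \<and> (\<forall>c. x [:c:] = v c)}"

definition berkovich_topology :: "('k::field \<Rightarrow> real) \<Rightarrow> ('k poly \<Rightarrow> real) topology" where
  "berkovich_topology v =
     topology_generated_by {{x \<in> berkovich_line v. x P \<in> U} | P U. open U}"

lemma topspace_berkovich_topology [simp]:
  "topspace (berkovich_topology v) = berkovich_line v"
proof -
  have "berkovich_line v = {x \<in> berkovich_line v. x 0 \<in> UNIV}" by simp
  then have "berkovich_line v \<in> {{x \<in> berkovich_line v. x P \<in> U} | P U. open U}"
    using open_UNIV by blast
  then show ?thesis
    unfolding berkovich_topology_def topology_generated_by_topspace by blast
qed

lemma continuous_map_berkovich_eval:
  "continuous_map (berkovich_topology v) euclideanreal (\<lambda>x. x P)"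
proof -
  have "openin (berkovich_topology v) {x \<in> berkovich_line v. x P \<in> U}" if "open U" for U
    unfolding berkovich_topology_def
    by (rule topology_generated_by_Basis) (use that in blast)
  then show ?thesis
    by (auto simp: continuous_map_def)
qed

lemma berkovich_topology_coarsest:
  assumes "topspace X = berkovich_line v"
    and "\<And>P. continuous_map X euclideanreal (\<lambda>x. x P)"
    and "openin (berkovich_topology v) W"
  shows "openin X W"
proof -
  have "openin X B" if B: "B \<in> {{x \<in> berkovich_line v. x P \<in> U} | P U. open U}" for B
  proof -
    from B obtain P U where "B = {x \<in> topspace X. x P \<in> U}" "open U"
      using assms(1) by auto
    then show ?thesis
      using openin_continuous_map_preimage[OF assms(2)[of P], of U] by simp
  qed
  then show ?thesis
    using assms(3) generate_topology_on_coarsest[OF istopology_openin]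
    unfolding berkovich_topology_def openin_topology_generated_by_iff by blast
qed

text \<open>Constant paths are admitted so that there is a path from a point to itself; a path between
  distinct points is never constant, and an injective one on \<open>{0..1}\<close> never has equal endpoints.\<close>

definition injective_path_from_to ::
    "'a topology \<Rightarrow> 'a \<Rightarrow> 'a \<Rightarrow> (real \<Rightarrow> 'a) \<Rightarrow> bool" where
  "injective_path_from_to X x y g \<longleftrightarrow>
     pathin X g \<and> g 0 = x \<and> g 1 = y \<and>
     (inj_on g {0..1} \<or> (\<forall>t\<in>{0..1}. g t = x))"

text \<open>Injective paths up to reparametrization, that is, identified with their images.\<close>

definition injective_paths :: "'a topology \<Rightarrow> 'a \<Rightarrow> 'a \<Rightarrow> 'a set set" where
  "injective_paths X x y = {g ` {0..1} | g. injective_path_from_to X x y g}"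

end

theory Submission imports Defs begin

text \<open>
  Order the points of the line pointwise. Every point \<open>x\<close> flows upwards through
  \<open>x\<^sub>r(P) = max\<^sub>i x(D\<^sub>i P) r\<^sup>i\<close>, with \<open>D\<^sub>i\<close> the Hasse derivatives; this is the Gauss norm of radius \<open>r\<close>
  of \<open>P(T + S)\<close>. MacLane's key polynomials replace the passage to an algebraic closure: if \<open>u < z\<close>
  and \<open>P\<close> has least degree with \<open>u(P) < z(P)\<close>, then \<open>w(P) \<le> z(P)\<close> already forces \<open>w \<le> z\<close>. Hence the
  points above \<open>x\<close> are exactly the \<open>x\<^sub>r\<close>, so they form a chain, and two points \<open>x, y\<close> have a least
  upper bound \<open>z\<close>; the path from \<open>x\<close> to \<open>y\<close> is \<open>[x, z] \<union> [y, z]\<close>. The same fact makes the branches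
  below a point \<open>w\<close> open, so every \<open>w\<close> on this path separates \<open>x\<close> from \<open>y\<close>, and every connected set
  containing \<open>x\<close> and \<open>y\<close> contains the path.
\<close>

section \<open>Multiplicative ultrametric seminorms and Gauss norms\<close>

text \<open>Geometric decay beats the linear factor: for \<open>b < a\<close> the bound divided by
  \<open>a ^ n\<close> tends to 0. This takes \<open>n\<close>-th roots of estimates, both for the
  ultrametric inequality and to drop a constant factor.\<close>

lemma le_of_power_le_linear_mult_power:
  fixes a b C :: real
  assumes "0 \<le> b" and bound: "\<And>n. a ^ n \<le> C * (real n + 1) * b ^ n"
  shows "a \<le> b"
proof (rule ccontr)
  assume "\<not> a \<le> b"
  then have a: "b < a" "0 < a" using \<open>0 \<le> b\<close> by auto
  define q where "q = b / a"
  have q: "0 \<le> q" "q < 1" using a \<open>0 \<le> b\<close> by (auto simp: q_def)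
  have "(\<lambda>n. C * (real n * q ^ n + q ^ n)) \<longlonglongrightarrow> C * (0 + 0)"
    using q by (intro tendsto_intros powser_times_n_limit_0 LIMSEQ_realpow_zero) auto
  then have lim: "(\<lambda>n. C * (real n * q ^ n + q ^ n)) \<longlonglongrightarrow> 0" by simp
  have "1 \<le> C * (real n * q ^ n + q ^ n)" for n
  proof -
    have "a ^ n / a ^ n \<le> C * (real n + 1) * b ^ n / a ^ n"
      using bound[of n] a by (intro divide_right_mono) auto
    then show ?thesis using a by (simp add: q_def power_divide field_simps)
  qed
  then have "1 \<le> (0::real)"
    by (intro tendsto_lowerbound[OF lim]) auto
  then show False by simp
qed

lemma continuous_on_Max_image:
  fixes f :: "'i \<Rightarrow> 'a::topological_space \<Rightarrow> real"
  assumes "finite A" "A \<noteq> {}" "\<And>i. i \<in> A \<Longrightarrow> continuous_on S (f i)"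
  shows "continuous_on S (\<lambda>t. Max ((\<lambda>i. f i t) ` A))"
  using assms
proof (induction A rule: finite_ne_induct)
  case (insert i A)
  then have "(\<lambda>t. Max ((\<lambda>i. f i t) ` insert i A)) = (\<lambda>t. max (f i t) (Max ((\<lambda>i. f i t) ` A)))"
    by (simp add: fun_eq_iff)
  then show ?case using insert by (auto intro!: continuous_on_max)
qed simp

text \<open>The range \<open>{..degree F}\<close> is nonempty even for \<open>F = 0\<close>. Used
  with \<open>N = v\<close> on \<open>k[T]\<close> and with \<open>N\<close> a point of the line on
  \<open>k[T][S]\<close>.\<close>

definition gauss_norm :: "('a::zero \<Rightarrow> real) \<Rightarrow> real \<Rightarrow> 'a poly \<Rightarrow> real" where
  "gauss_norm N r F = Max ((\<lambda>i. N (coeff F i) * r ^ i) ` {..degree F})"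

lemma continuous_on_gauss_norm: "continuous_on S (\<lambda>r. gauss_norm N r F)"
  unfolding gauss_norm_def
  by (intro continuous_on_Max_image continuous_intros) auto

text \<open>Stated over any commutative ring so that it covers the field, its polynomials and
  polynomials over these; the kernel may be nonzero.\<close>

locale nonarch_mult_seminorm =
  fixes N :: "'a::comm_ring_1 \<Rightarrow> real"
  assumes nonneg: "0 \<le> N f"
    and zero [simp]: "N 0 = 0"
    and one [simp]: "N 1 = 1"
    and mult: "N (f * g) = N f * N g"
    and ultrametric: "N (f + g) \<le> max (N f) (N g)"
begin

lemma power: "N (f ^ n) = N f ^ n"
  by (induction n) (simp_all add: mult)

lemma uminus: "N (- f) = N f"
proof -
  have "N (-1) * N (-1) = 1" using mult[of "-1" "-1"] by simp
  then have "N (-1) = 1"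
    using nonneg[of "-1"] by (metis abs_of_nonneg abs_1 real_sqrt_abs2 real_sqrt_one)
  then show ?thesis using mult[of "-1" f] by simp
qed

lemma diff_ultrametric: "N (f - g) \<le> max (N f) (N g)"
  using ultrametric[of f "- g"] by (simp add: uminus)

lemma sum_le:
  assumes "0 \<le> c" "\<And>i. i \<in> A \<Longrightarrow> N (f i) \<le> c"
  shows "N (sum f A) \<le> c"
  using assms
proof (induction A rule: infinite_finite_induct)
  case (insert i A)
  have "N (f i) \<le> c" "N (sum f A) \<le> c" using insert by auto
  then show ?case using insert.hyps ultrametric[of "f i" "sum f A"] by simp
qed auto

lemma add_eq_left:
  assumes "N g < N f"
  shows "N (f + g) = N f"
  using ultrametric[of f g] diff_ultrametric[of "f + g" g] assms by auto

lemma add_eq_right: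
  assumes "N g < N f"
  shows "N (g + f) = N f"
  using add_eq_left[OF assms] by (simp add: add.commute)

lemma gauss_norm_ge:
  assumes "0 \<le> r"
  shows "N (coeff F i) * r ^ i \<le> gauss_norm N r F"
proof (cases "i \<le> degree F")
  case True
  then show ?thesis unfolding gauss_norm_def by (intro Max_ge) auto
next
  case False
  have "0 \<le> N (coeff F 0) * r ^ 0" using nonneg by simp
  also have "\<dots> \<le> gauss_norm N r F" unfolding gauss_norm_def by (intro Max_ge imageI) auto
  finally show ?thesis using False by (simp add: coeff_eq_0)
qed

lemma gauss_norm_attained: "\<exists>i. gauss_norm N r F = N (coeff F i) * r ^ i"
proof -
  have "gauss_norm N r F \<in> (\<lambda>i. N (coeff F i) * r ^ i) ` {..degree F}"
    unfolding gauss_norm_def by (intro Max_in) auto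
  then show ?thesis by blast
qed

lemma gauss_norm_mono:
  assumes "0 \<le> r" "r \<le> s"
  shows "gauss_norm N r F \<le> gauss_norm N s F"
proof -
  obtain i where i: "gauss_norm N r F = N (coeff F i) * r ^ i" using gauss_norm_attained by blast
  also have "\<dots> \<le> N (coeff F i) * s ^ i" by (intro mult_left_mono power_mono assms nonneg)
  also have "\<dots> \<le> gauss_norm N s F" by (rule gauss_norm_ge) (use assms in auto)
  finally show ?thesis .
qed

lemma gauss_norm_const [simp]: "gauss_norm N r [:c:] = N c"
  by (simp add: gauss_norm_def)

text \<open>Gauss's lemma. For the lower bound take the least indices \<open>i\<close>,
  \<open>j\<close> at which the two maxima are attained: in the coefficient of index
  \<open>i + j\<close> a single term dominates strictly, so nothing cancels.\<close>

lemma gauss_norm_mult: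
  assumes r: "0 \<le> r"
  shows "gauss_norm N r (F * G) = gauss_norm N r F * gauss_norm N r G" (is "?n (F * G) = _")
proof (rule antisym)
  have term_le: "N (coeff F l * coeff G k) * r ^ (l + k) \<le> ?n F * ?n G" for l k
  proof -
    have "(N (coeff F l) * r ^ l) * (N (coeff G k) * r ^ k) \<le> ?n F * ?n G"
      using r nonneg gauss_norm_ge[OF r] by (intro mult_mono) (auto intro: order_trans[OF _ gauss_norm_ge])
    then show ?thesis by (simp add: mult power_add mult_ac)
  qed
  have n0: "0 \<le> ?n H" for H
    using gauss_norm_ge[OF r, of H 0] nonneg[of "coeff H 0"] by simp
  obtain n where n: "?n (F * G) = N (coeff (F * G) n) * r ^ n" using gauss_norm_attained by blast
  show "?n (F * G) \<le> ?n F * ?n G"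
  proof (cases "r ^ n = 0")
    case True
    then have "?n (F * G) = 0" using n by simp
    then show ?thesis using n0 by simp
  next
    case False
    then have rn: "0 < r ^ n" using r by (metis less_eq_real_def zero_le_power)
    have "N (coeff (F * G) n) \<le> ?n F * ?n G / r ^ n"
      unfolding coeff_mult
    proof (rule sum_le)
      fix i assume "i \<in> {..n}"
      then show "N (coeff F i * coeff G (n - i)) \<le> ?n F * ?n G / r ^ n"
        using term_le[of i "n - i"] rn by (simp add: pos_le_divide_eq)
    qed (use n0 rn in auto)
    then show ?thesis using n rn by (simp add: pos_le_divide_eq)
  qed
  define i where "i = (LEAST i. N (coeff F i) * r ^ i = ?n F)"
  define j where "j = (LEAST j. N (coeff G j) * r ^ j = ?n G)"
  have i: "N (coeff F i) * r ^ i = ?n F" unfolding i_def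
    using gauss_norm_attained[of r F] by (metis (mono_tags, lifting) LeastI)
  have j: "N (coeff G j) * r ^ j = ?n G" unfolding j_def
    using gauss_norm_attained[of r G] by (metis (mono_tags, lifting) LeastI)
  have li: "N (coeff F l) * r ^ l < ?n F" if "l < i" for l
    using not_less_Least[of l "\<lambda>i. N (coeff F i) * r ^ i = ?n F"] that gauss_norm_ge[OF r, of F l]
    unfolding i_def by fastforce
  have lj: "N (coeff G l) * r ^ l < ?n G" if "l < j" for l
    using not_less_Least[of l "\<lambda>i. N (coeff G i) * r ^ i = ?n G"] that gauss_norm_ge[OF r, of G l]
    unfolding j_def by fastforce
  show "?n F * ?n G \<le> ?n (F * G)"
  proof (cases "?n F * ?n G = 0")
    case True
    show ?thesis unfolding True by (rule n0)
  next
    case False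
    then have pos: "0 < ?n F" "0 < ?n G" using n0[of F] n0[of G] by auto
    \<comment> \<open>\<open>r = 0\<close> is allowed, but a positive maximum attained at
      \<open>i\<close> forces \<open>r ^ i > 0\<close>.\<close>
    have nz: "0 < r ^ (i + j)" using i j pos r
      by (metis less_eq_real_def mult_zero_right power_add zero_le_power mult_eq_0_iff)
    have lead: "N (coeff F i * coeff G j) * r ^ (i + j) = ?n F * ?n G"
      using i j by (simp add: mult power_add mult_ac flip: i j)
    \<comment> \<open>If \<open>l + k = i + j\<close> and \<open>l \<noteq> i\<close>, then
      \<open>l < i\<close> or \<open>k < j\<close>, and minimality makes that factor strictly
      smaller.\<close>
    have rest: "N (coeff F l * coeff G (i + j - l)) \<le> N (coeff F i * coeff G j) \<and>
      N (coeff F l * coeff G (i + j - l)) \<noteq> N (coeff F i * coeff G j)" if l: "l \<le> i + j" "l \<noteq> i" for l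
    proof -
      define k where "k = i + j - l"
      have lk: "l + k = i + j" using l by (simp add: k_def)
      have "(N (coeff F l) * r ^ l) * (N (coeff G k) * r ^ k) < ?n F * ?n G"
      proof (cases "l < i")
        case True
        have "(N (coeff F l) * r ^ l) * (N (coeff G k) * r ^ k) \<le> (N (coeff F l) * r ^ l) * ?n G"
          using r nonneg gauss_norm_ge[OF r] by (intro mult_left_mono) auto
        also have "\<dots> < ?n F * ?n G" using li[OF True] pos by (intro mult_strict_right_mono)
        finally show ?thesis .
      next
        case False
        then have "k < j" using l lk by linarith
        have "(N (coeff F l) * r ^ l) * (N (coeff G k) * r ^ k) \<le> ?n F * (N (coeff G k) * r ^ k)"
          using r nonneg gauss_norm_ge[OF r] by (intro mult_right_mono) auto
        also have "\<dots> < ?n F * ?n G" using lj[OF \<open>k < j\<close>] pos by (intro mult_strict_left_mono)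
        finally show ?thesis .
      qed
      then have "N (coeff F l * coeff G k) * r ^ (i + j) < N (coeff F i * coeff G j) * r ^ (i + j)"
        unfolding lead by (simp add: mult power_add mult_ac flip: lk)
      then show ?thesis using nz by (simp add: k_def)
    qed
    define R where "R = (\<Sum>l\<in>{..i + j} - {i}. coeff F l * coeff G (i + j - l))"
    have "coeff (F * G) (i + j) = coeff F i * coeff G j + R"
      unfolding coeff_mult R_def by (subst sum.remove[of _ i]) auto
    moreover have "N R < N (coeff F i * coeff G j)"
    \<comment> \<open>\<open>Max\<close> needs a nonempty index set; if there are no other terms,
      \<open>R\<close> is 0.\<close>
    proof (cases "{..i + j} - {i} = {}")
      case True
      have "0 < N (coeff F i * coeff G j) * r ^ (i + j)" using lead pos by simp
      then have "0 < N (coeff F i * coeff G j)" using nz by (rule zero_less_mult_pos2)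
      moreover have "R = 0" unfolding R_def True by (rule sum.empty)
      ultimately show ?thesis by simp
    next
      case False
      define c where "c = Max ((\<lambda>l. N (coeff F l * coeff G (i + j - l))) ` ({..i + j} - {i}))"
      have "N R \<le> c" unfolding R_def
      proof (rule sum_le)
        show le: "N (coeff F l * coeff G (i + j - l)) \<le> c" if "l \<in> {..i + j} - {i}" for l
          unfolding c_def using that by (intro Max_ge) auto
        obtain l where "l \<in> {..i + j} - {i}" using False by blast
        from le[OF this] show "0 \<le> c" using nonneg by (rule order_trans[rotated])
      qed
      moreover have "c < N (coeff F i * coeff G j)"
        unfolding c_def using False rest by (subst Max_less_iff) (auto simp: less_le)
      ultimately show ?thesis by simp
    qed
    ultimately have "N (coeff (F * G) (i + j)) = N (coeff F i * coeff G j)"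
      by (simp add: add_eq_left)
    then have "?n F * ?n G = N (coeff (F * G) (i + j)) * r ^ (i + j)" using lead by simp
    also have "\<dots> \<le> ?n (F * G)" by (rule gauss_norm_ge[OF r])
    finally show ?thesis .
  qed
qed

lemma gauss_norm_add:
  assumes r: "0 \<le> r"
  shows "gauss_norm N r (F + G) \<le> max (gauss_norm N r F) (gauss_norm N r G)"
proof -
  obtain n where n: "gauss_norm N r (F + G) = N (coeff (F + G) n) * r ^ n"
    using gauss_norm_attained by blast
  also have "\<dots> \<le> max (N (coeff F n)) (N (coeff G n)) * r ^ n"
    using r ultrametric by (intro mult_right_mono) auto
  also have "\<dots> = max (N (coeff F n) * r ^ n) (N (coeff G n) * r ^ n)"
    using r by (simp add: max_mult_distrib_right)
  also have "\<dots> \<le> max (gauss_norm N r F) (gauss_norm N r G)"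
    using gauss_norm_ge[OF r] by (intro max.mono) auto
  finally show ?thesis .
qed

lemma nonarch_mult_seminorm_gauss_norm:
  assumes "0 \<le> r"
  shows "nonarch_mult_seminorm (gauss_norm N r)"
proof
  show "0 \<le> gauss_norm N r f" for f
    using gauss_norm_ge[OF assms, of f 0] nonneg[of "coeff f 0"] by simp
  show "gauss_norm N r 0 = 0" "gauss_norm N r 1 = 1"
    by (simp_all add: gauss_norm_def)
qed (use assms gauss_norm_mult gauss_norm_add in auto)

end

section \<open>The Taylor expansion and the flow\<close>

text \<open>\<open>P(T)\<close> is sent to \<open>P(T + S)\<close>, a polynomial in \<open>S\<close> over \<open>k[T]\<close>; its coefficients are the
  Hasse derivatives of \<open>P\<close>.\<close>

definition taylor :: "'a::comm_ring_1 poly \<Rightarrow> 'a poly poly" where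
  "taylor P = pcompose (map_poly (\<lambda>c. [:c:]) P) [:[:0, 1:], 1:]"

lemma taylor_pCons: "taylor (pCons a p) = [:[:a:]:] + [:[:0, 1:], 1:] * taylor p"
  unfolding taylor_def by (subst map_poly_pCons) (auto simp: pcompose_pCons)

lemma taylor_0 [simp]: "taylor 0 = 0"
  by (simp add: taylor_def)

lemma taylor_const [simp]: "taylor [:c:] = [:[:c:]:]"
  by (simp add: taylor_pCons)

lemma taylor_add: "taylor (p + q) = taylor p + taylor q"
proof (induction p q rule: poly_induct2)
  case (pCons a p b q)
  have const: "[:[:a + b:]:] = [:[:a:]:] + [:[:b:]:]" by simp
  show ?case
    unfolding add_pCons taylor_pCons pCons.IH unfolding const by (simp only: algebra_simps)
qed simp

lemma taylor_smult: "taylor (smult c p) = [:[:c:]:] * taylor p"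
proof (induction p)
  case (pCons a p)
  have const: "[:[:c * a:]:] = [:[:c:]:] * [:[:a:]:]" by simp
  show ?case
    unfolding smult_pCons taylor_pCons pCons.IH const by (simp only: algebra_simps)
qed simp

lemma taylor_mult: "taylor (p * q) = taylor p * taylor q"
proof (induction p)
  case (pCons a p)
  have const: "[:[:0:]:] = (0 :: 'a poly poly)" by simp
  show ?case
    unfolding mult_pCons_left[of a p]
    unfolding taylor_add taylor_smult taylor_pCons pCons.IH const
    by (simp only: algebra_simps add_0_left)
qed simp

text \<open>Putting \<open>S = 0\<close> returns \<open>P\<close>; hence the flow starts at
  \<open>x\<close> and stays above it.\<close>

lemma coeff_0_taylor [simp]: "coeff (taylor p) 0 = p"
  by (induction p) (simp_all add: taylor_pCons coeff_mult_0)

text \<open>For the Gauss norm of a disc of radius \<open>s\<close> this is the Gauss norm of the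
  concentric disc of radius \<open>max r s\<close>, so the flow may rest before it moves.\<close>

definition flow :: "('a::comm_ring_1 poly \<Rightarrow> real) \<Rightarrow> real \<Rightarrow> 'a poly \<Rightarrow> real" where
  "flow x r P = gauss_norm x r (taylor P)"

lemma continuous_on_flow: "continuous_on S (\<lambda>r. flow x r P)"
  unfolding flow_def by (rule continuous_on_gauss_norm)

section \<open>Points of the line and their flow\<close>

context nonarch_valued_field
begin

lemma nonarch_mult_seminorm: "nonarch_mult_seminorm v"
proof
  have "v 1 = v 1 * v 1" using mult[of 1 1] by simp
  then show "v 1 = 1" using eq_0_iff[of 1] by simp
qed (auto simp: nonneg eq_0_iff mult ultrametric)

lemma of_nat_le_1: "v (of_nat n) \<le> 1"
proof -
  interpret v: nonarch_mult_seminorm v by (rule nonarch_mult_seminorm)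
  show ?thesis
  proof (induction n)
    case (Suc n)
    then show ?case using ultrametric[of 1 "of_nat n"] by simp
  qed simp
qed

text \<open>A point is only required to satisfy the triangle inequality. The binomial expansion of
  \<open>(f + g) ^ n\<close> has \<open>n + 1\<close> terms of value at most \<open>M ^ n\<close>,
  because integers have value at most 1; \<open>n\<close>-th roots give the ultrametric
  inequality.\<close>

lemma berkovich_lineD:
  assumes "x \<in> berkovich_line v"
  shows "nonarch_mult_seminorm x"
proof -
  have s: "mult_seminorm x" and c: "x [:c:] = v c" for c
    using assms by (auto simp: berkovich_line_def)
  have nonneg: "0 \<le> x f" and zero: "x 0 = 0" and one: "x 1 = 1" and
    tri: "x (f + g) \<le> x f + x g" and mult: "x (f * g) = x f * x g" for f g
    using s by (auto simp: mult_seminorm_def)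
  have pow: "x (f ^ n) = x f ^ n" for f n
    by (induction n) (simp_all add: one mult)
  have sum: "x (\<Sum>i\<in>A. h i) \<le> (\<Sum>i\<in>A. x (h i))" for A :: "nat set" and h
  proof (induction A rule: infinite_finite_induct)
    case (insert i A)
    then show ?case using tri[of "h i" "sum h A"] by simp
  qed (simp_all add: zero)
  show ?thesis
  proof
    fix f g
    define M where "M = max (x f) (x g)"
    have M: "0 \<le> M" "x f \<le> M" "x g \<le> M" using nonneg[of f] by (auto simp: M_def)
    have "x (f + g) ^ n \<le> 1 * (real n + 1) * M ^ n" for n
    proof -
      have "x (f + g) ^ n = x (\<Sum>k\<le>n. of_nat (n choose k) * f ^ k * g ^ (n - k))"
        by (simp add: binomial_ring flip: pow)
      also have "\<dots> \<le> (\<Sum>k\<le>n. x (of_nat (n choose k) * f ^ k * g ^ (n - k)))"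
        by (rule sum)
      also have "\<dots> \<le> (\<Sum>k\<le>n. M ^ n)"
      proof (rule sum_mono)
        fix k assume k: "k \<in> {..n}"
        have "x (of_nat (n choose k)) \<le> 1"
          using of_nat_le_1[of "n choose k"] c[of "of_nat (n choose k)"] by (simp add: of_nat_poly)
        then have "x (of_nat (n choose k)) * x f ^ k * x g ^ (n - k) \<le> 1 * M ^ k * M ^ (n - k)"
          using M nonneg by (intro mult_mono power_mono) auto
        then show "x (of_nat (n choose k) * f ^ k * g ^ (n - k)) \<le> M ^ n"
          using k by (simp add: mult pow flip: power_add)
      qed
      finally show ?thesis by (simp add: add.commute)
    qed
    then show "x (f + g) \<le> max (x f) (x g)"
      unfolding M_def[symmetric] by (rule le_of_power_le_linear_mult_power[OF M(1)])
  qed (auto simp: nonneg zero one mult)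
qed

lemma berkovich_lineI:
  assumes "nonarch_mult_seminorm x" "\<And>c. x [:c:] = v c"
  shows "x \<in> berkovich_line v"
proof -
  interpret x: nonarch_mult_seminorm x by (rule assms)
  have "x (f + g) \<le> x f + x g" for f g
    using x.ultrametric[of f g] x.nonneg[of f] x.nonneg[of g] by linarith
  then show ?thesis
    using assms(2) by (auto simp: berkovich_line_def mult_seminorm_def x.nonneg x.mult)
qed

lemma berkovich_line_const: "x \<in> berkovich_line v \<Longrightarrow> x [:c:] = v c"
  by (simp add: berkovich_line_def)

text \<open>A Gauss norm pulled back along the ring homomorphism \<open>taylor\<close>.\<close>

lemma flow_in_berkovich_line:
  assumes x: "x \<in> berkovich_line v" and r: "0 \<le> r"
  shows "flow x r \<in> berkovich_line v"
proof -
  interpret x: nonarch_mult_seminorm x using x by (rule berkovich_lineD)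
  interpret g: nonarch_mult_seminorm "gauss_norm x r"
    using r by (rule x.nonarch_mult_seminorm_gauss_norm)
  show ?thesis
  proof (rule berkovich_lineI)
    show "nonarch_mult_seminorm (flow x r)"
      unfolding flow_def[abs_def]
    proof
      have "taylor 1 = (1 :: 'k poly poly)" using taylor_const[of 1] by (simp flip: one_pCons)
      then show "gauss_norm x r (taylor 1) = 1" by simp
    qed (simp_all add: taylor_mult taylor_add g.nonneg g.mult g.ultrametric)
    show "flow x r [:c:] = v c" for c
      using x by (simp add: flow_def berkovich_line_const)
  qed
qed

text \<open>Since \<open>0 ^ 0 = 1\<close>, exactly the coefficient of index 0 survives, which is
  \<open>P\<close>.\<close>

lemma flow_0:
  assumes x: "x \<in> berkovich_line v"
  shows "flow x 0 = x"
proof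
  fix P
  interpret x: nonarch_mult_seminorm x using x by (rule berkovich_lineD)
  obtain i where i: "flow x 0 P = x (coeff (taylor P) i) * 0 ^ i"
    unfolding flow_def using x.gauss_norm_attained by blast
  have "x P \<le> flow x 0 P" using x.gauss_norm_ge[of 0 "taylor P" 0] by (simp add: flow_def)
  moreover have "flow x 0 P \<le> x P" using i x.nonneg[of P] by (cases i) auto
  ultimately show "flow x 0 P = x P" by simp
qed

lemma flow_mono:
  assumes x: "x \<in> berkovich_line v" and "0 \<le> r" "r \<le> s"
  shows "flow x r \<le> flow x s"
proof -
  interpret x: nonarch_mult_seminorm x using x by (rule berkovich_lineD)
  show ?thesis using assms by (auto simp: le_fun_def flow_def intro: x.gauss_norm_mono)
qed

lemma le_flow:
  assumes "x \<in> berkovich_line v" "0 \<le> r"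
  shows "x \<le> flow x r"
  using flow_mono[OF assms(1) _ assms(2)] flow_0[OF assms(1)] by simp

text \<open>\<open>T\<close> expands to \<open>T + S\<close>, with linear coefficient 1. This bounds
  the time for which a flow can stay below a given point.\<close>

lemma flow_unbounded:
  assumes x: "x \<in> berkovich_line v" and "0 \<le> r"
  shows "r \<le> flow x r [:0, 1:]"
proof -
  interpret x: nonarch_mult_seminorm x using x by (rule berkovich_lineD)
  have "coeff (taylor [:0, 1:]) 1 = (1 :: 'k poly)"
    by (simp add: taylor_pCons one_pCons)
  then show ?thesis using x.gauss_norm_ge[OF assms(2), of "taylor [:0, 1:]" 1] by (simp add: flow_def)
qed

text \<open>A nonzero term of index \<open>i > 0\<close> grows strictly with the radius. So a flow
  that has left \<open>x\<close> never rests again, whence its injectivity.\<close>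

lemma flow_eq_imp_eq_start:
  assumes x: "x \<in> berkovich_line v" and r: "0 \<le> s" "s < r" and eq: "flow x s = flow x r"
  shows "flow x s = x"
proof
  fix P
  interpret x: nonarch_mult_seminorm x using x by (rule berkovich_lineD)
  obtain i where i: "flow x s P = x (coeff (taylor P) i) * s ^ i"
    unfolding flow_def using x.gauss_norm_attained by blast
  have le: "x (coeff (taylor P) i) * r ^ i \<le> flow x s P"
    unfolding eq unfolding flow_def using r by (intro x.gauss_norm_ge) auto
  have ge: "x P \<le> flow x s P" using le_flow[OF x r(1)] by (simp add: le_fun_def)
  show "flow x s P = x P"
  proof (cases "i = 0")
    case False
    then have "s ^ i < r ^ i" using r by (intro power_strict_mono) auto
    then have "x (coeff (taylor P) i) = 0"
      using le i x.nonneg[of "coeff (taylor P) i"] by (metis linorder_not_less mult_strict_left_mono order_less_le)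
    then show ?thesis using i ge x.nonneg[of P] by simp
  qed (use i in simp)
qed

text \<open>With \<open>T\<close> bounded by \<open>r\<close>, every monomial of \<open>P\<close> is
  bounded by its term in the Gauss norm.\<close>

lemma le_gauss_norm:
  assumes x: "x \<in> berkovich_line v" and r: "x [:0, 1:] \<le> r"
  shows "x \<le> gauss_norm v r"
proof (rule le_funI)
  fix P
  interpret v: nonarch_mult_seminorm v by (rule nonarch_mult_seminorm)
  interpret x: nonarch_mult_seminorm x using x by (rule berkovich_lineD)
  have r0: "0 \<le> r" using r x.nonneg by (rule order_trans[rotated])
  interpret g: nonarch_mult_seminorm "gauss_norm v r"
    using r0 by (rule v.nonarch_mult_seminorm_gauss_norm)
  have "x (\<Sum>i\<le>degree P. monom (coeff P i) i) \<le> gauss_norm v r P"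
  proof (rule x.sum_le)
    fix i
    have "x (monom (coeff P i) i) = v (coeff P i) * x [:0, 1:] ^ i"
      using x.mult[of "[:coeff P i:]" "[:0, 1:] ^ i"]
      by (simp add: monom_altdef x.power berkovich_line_const[OF x])
    also have "\<dots> \<le> v (coeff P i) * r ^ i"
      using r x.nonneg by (intro mult_left_mono power_mono v.nonneg) auto
    also have "\<dots> \<le> gauss_norm v r P" using r0 by (rule v.gauss_norm_ge)
    finally show "x (monom (coeff P i) i) \<le> gauss_norm v r P" .
  qed (rule g.nonneg)
  then show "x P \<le> gauss_norm v r P" by (simp add: poly_as_sum_of_monoms)
qed

lemma ex_upper_bound:
  assumes "x \<in> berkovich_line v" "y \<in> berkovich_line v"
  shows "\<exists>z\<in>berkovich_line v. x \<le> z \<and> y \<le> z"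
proof -
  interpret v: nonarch_mult_seminorm v by (rule nonarch_mult_seminorm)
  interpret x: nonarch_mult_seminorm x using assms by (intro berkovich_lineD)
  define r where "r = max (x [:0, 1:]) (y [:0, 1:])"
  have "0 \<le> r" using x.nonneg[of "[:0, 1:]"] by (simp add: r_def)
  then have "gauss_norm v r \<in> berkovich_line v"
    by (intro berkovich_lineI v.nonarch_mult_seminorm_gauss_norm v.gauss_norm_const)
  then show ?thesis
    using le_gauss_norm[of x r] le_gauss_norm[of y r] assms by (auto simp: r_def)
qed

end

section \<open>Key polynomials and the order\<close>

context complete_nonarch_valued_field
begin

lemma ex_limit_of_Cauchy:
  assumes "\<And>e. 0 < e \<Longrightarrow> \<exists>K. \<forall>m\<ge>K. \<forall>n\<ge>K. v (s m - s n) < e"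
  obtains l where "(\<lambda>n. v (s n - l)) \<longlonglongrightarrow> 0"
proof -
  have "MCauchy s" unfolding MCauchy_def using assms by (metis subset_UNIV)
  then obtain l where l: "limitin mtopology s l sequentially"
    using complete unfolding mcomplete_def by blast
  have "(\<lambda>n. v (s n - l)) \<longlonglongrightarrow> 0"
    using l by (auto simp: limit_metric_sequentially lim_sequentially dist_real_def nonneg)
  then show ?thesis by (rule that)
qed

text \<open>Completeness of the field enters only here: it makes the norms on a finite-dimensional space
  equivalent.\<close>

lemma coeff_le_seminorm:
  assumes z: "z \<in> berkovich_line v" and ker: "\<And>f. z f = 0 \<Longrightarrow> f = 0"
  shows "\<exists>C>0. \<forall>h. (\<forall>i\<ge>n. coeff h i = 0) \<longrightarrow> (\<forall>i. v (coeff h i) \<le> C * z h)"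
proof (induction n)
  case 0
  have "h = 0" if "\<forall>i. coeff h i = 0" for h :: "'a poly"
    using that by (simp add: poly_eq_iff)
  then have "v (coeff h i) \<le> 1 * z h" if "\<forall>i\<ge>0. coeff h i = 0" for h i
    using that eq_0_iff[of 0] nonarch_mult_seminorm.nonneg[OF berkovich_lineD[OF z], of h] by simp
  then show ?case by (meson zero_less_one)
next
  case (Suc n)
  interpret v: nonarch_mult_seminorm v by (rule nonarch_mult_seminorm)
  interpret z: nonarch_mult_seminorm z using z by (rule berkovich_lineD)
  define X where "X = (\<lambda>i. monom 1 i :: 'a poly)"
  have monom: "z (monom c i) = v c * z (X i)" for c i
    using z.mult[of "[:c:]" "X i"] by (simp add: X_def smult_monom berkovich_line_const[OF z])
  obtain C where "0 < C" and C: "\<And>h i. \<forall>i\<ge>n. coeff h i = 0 \<Longrightarrow> v (coeff h i) \<le> C * z h"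
    using Suc.IH by blast
  \<comment> \<open>The monomial of degree \<open>n\<close> keeps a positive distance from the
    polynomials of lower degree. Otherwise approximating \<open>h k\<close> are Cauchy in each
    coefficient by the induction hypothesis, and their limit \<open>g\<close> gives a monic
    \<open>X n + g\<close> in the kernel.\<close>
  have "\<exists>e>0. \<forall>h. (\<forall>i\<ge>n. coeff h i = 0) \<longrightarrow> e \<le> z (X n + h)"
  proof (rule ccontr)
    assume "\<not> ?thesis"
    then have "\<exists>h. (\<forall>i\<ge>n. coeff h i = 0) \<and> z (X n + h) < e" if "0 < e" for e
      using that by (auto simp: not_le)
    then have "\<exists>h. (\<forall>i\<ge>n. coeff h i = 0) \<and> z (X n + h) < 1 / real (Suc k)" for k
      by simp
    then obtain h where h0: "\<And>k i. n \<le> i \<Longrightarrow> coeff (h k) i = 0"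
      and h: "\<And>k. z (X n + h k) < 1 / real (Suc k)" by metis
    have "\<exists>l. (\<lambda>k. v (coeff (h k) i - l)) \<longlonglongrightarrow> 0" for i
    proof (rule ex_limit_of_Cauchy)
      fix e :: real assume "0 < e"
      then obtain K where K: "1 / real (Suc K) < e / C"
        using \<open>0 < C\<close> nat_approx_posE[of "e / C"] by auto
      have "v (coeff (h m) i - coeff (h l) i) < e" if "K \<le> m" "K \<le> l" for m l
      proof -
        have "v (coeff (h m - h l) i) \<le> C * z (h m - h l)" using h0 by (intro C) auto
        also have "z (h m - h l) \<le> max (z (X n + h m)) (z (X n + h l))"
          using z.diff_ultrametric[of "X n + h m" "X n + h l"] by simp
        also have "\<dots> < e / C"
        proof -
          have "1 / real (Suc m) \<le> 1 / real (Suc K)" "1 / real (Suc l) \<le> 1 / real (Suc K)"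
            using that by (auto intro!: divide_left_mono)
          then show ?thesis using h[of m] h[of l] K by linarith
        qed
        finally show ?thesis using \<open>0 < C\<close> by (simp add: pos_less_divide_eq mult.commute)
      qed
      then show "\<exists>K. \<forall>m\<ge>K. \<forall>l\<ge>K. v (coeff (h m) i - coeff (h l) i) < e" by blast
    qed blast
    then obtain l where l: "\<And>i. (\<lambda>k. v (coeff (h k) i - l i)) \<longlonglongrightarrow> 0" by metis
    define g where "g = (\<Sum>i<n. monom (l i) i)"
    have hsum: "h k = (\<Sum>i<n. monom (coeff (h k) i) i)" for k
      by (rule poly_eqI) (auto simp: coeff_sum h0 not_less sum.delta intro: sum.cong)
    \<comment> \<open>The first summand bounds \<open>z (X n + h k)\<close>, the second the error
      \<open>h k - g\<close>; both tend to 0.\<close>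
    have "z (X n + g) \<le> 1 / real (Suc k) + (\<Sum>i<n. v (coeff (h k) i - l i) * z (X i))" for k
    proof -
      have "h k - g = (\<Sum>i<n. monom (coeff (h k) i - l i) i)"
        unfolding g_def by (subst hsum) (simp add: sum_subtractf flip: diff_monom)
      then have "z (h k - g) \<le> (\<Sum>i<n. v (coeff (h k) i - l i) * z (X i))"
        using v.nonneg z.nonneg
        by (auto simp: monom intro!: z.sum_le sum_nonneg member_le_sum)
      moreover have "z (X n + g) \<le> max (z (X n + h k)) (z (h k - g))"
        using z.diff_ultrametric[of "X n + h k" "h k - g"] by (simp add: algebra_simps)
      moreover have "0 \<le> z (h k - g)" "0 \<le> z (X n + h k)" by (rule z.nonneg)+
      ultimately show ?thesis using h[of k] by linarith
    qed
    moreover have "(\<lambda>k. 1 / real (Suc k) + (\<Sum>i<n. v (coeff (h k) i - l i) * z (X i)))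
        \<longlonglongrightarrow> 0 + (\<Sum>i<n. 0 * z (X i))"
      using LIMSEQ_inverse_real_of_nat
      by (intro tendsto_intros l) (simp add: inverse_eq_divide)
    ultimately have "z (X n + g) \<le> 0"
      by (intro tendsto_lowerbound[where F = sequentially]) auto
    then have "X n + g = 0" using ker z.nonneg[of "X n + g"] by auto
    moreover have "coeff (X n + g) n = 1"
      by (simp add: X_def g_def coeff_sum)
    ultimately show False by simp
  qed
  then obtain e where "0 < e" and e: "\<And>h. \<forall>i\<ge>n. coeff h i = 0 \<Longrightarrow> e \<le> z (X n + h)" by blast
  \<comment> \<open>\<open>1 / e\<close> serves the leading coefficient \<open>a\<close>; the rest
    serves the lower ones, through the induction hypothesis for
    \<open>h - monom a n\<close>.\<close>
  define D where "D = 1 / e + C * (1 + z (X n) / e)"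
  have "0 < D" using \<open>0 < e\<close> \<open>0 < C\<close> z.nonneg[of "X n"]
    by (auto simp: D_def intro!: add_pos_nonneg)
  moreover have "v (coeff h i) \<le> D * z h" if hS: "\<forall>i\<ge>Suc n. coeff h i = 0" for h i
  proof -
    define a where "a = coeff h n"
    define g where "g = h - monom a n"
    have g: "\<forall>i\<ge>n. coeff g i = 0"
      using hS by (auto simp: g_def a_def Suc_le_eq)
    have a: "v a \<le> z h / e"
    proof (cases "a = 0")
      case True
      then show ?thesis using \<open>0 < e\<close> z.nonneg by simp
    next
      case False
      \<comment> \<open>Dividing by the leading coefficient makes the distance estimate
        applicable.\<close>
      have "h = [:a:] * (X n + smult (1 / a) g)"
        using False by (simp add: X_def g_def smult_add_right smult_monom)
      then have "z h = v a * z (X n + smult (1 / a) g)"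
        by (metis z.mult berkovich_line_const[OF z])
      moreover have "e \<le> z (X n + smult (1 / a) g)" using g by (intro e) auto
      ultimately have "v a * e \<le> z h" using v.nonneg by (metis mult_left_mono)
      then show ?thesis using \<open>0 < e\<close> by (simp add: pos_le_divide_eq)
    qed
    have D1: "z h / e \<le> D * z h" and D2: "C * (z h + z h / e * z (X n)) \<le> D * z h"
      using \<open>0 < e\<close> \<open>0 < C\<close> z.nonneg by (auto simp: D_def field_simps)
    show ?thesis
    proof (cases "i = n")
      case True
      then show ?thesis using a D1 by (simp add: a_def)
    next
      case False
      then have "v (coeff h i) \<le> C * z g" using C[OF g, of i] by (simp add: g_def)
      also have "z g \<le> max (z h) (v a * z (X n))"
        using z.diff_ultrametric[of h "monom a n"] by (simp add: g_def monom)
      also have "\<dots> \<le> z h + v a * z (X n)" using z.nonneg v.nonneg by simp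
      also have "v a * z (X n) \<le> z h / e * z (X n)" using a z.nonneg by (intro mult_right_mono)
      finally show ?thesis using D2 \<open>0 < C\<close> by simp
    qed
  qed
  ultimately show ?case by blast
qed

text \<open>\<open>P\<close> is a key polynomial of \<open>z\<close> in the sense of MacLane: the terms of a \<open>P\<close>-adic expansion
  do not cancel under \<open>z\<close>.\<close>

lemma key_polynomial_division:
  assumes u: "u \<in> berkovich_line v" and z: "z \<in> berkovich_line v"
    and "u \<le> z" and "u P < z P" and min: "\<And>f. degree f < degree P \<Longrightarrow> u f = z f"
    and h: "degree h < degree P"
  shows "z h \<le> z (q * P + h)" "z (q * P) \<le> z (q * P + h)"
proof -
  interpret u: nonarch_mult_seminorm u using u by (rule berkovich_lineD)
  interpret z: nonarch_mult_seminorm z using z by (rule berkovich_lineD)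
  have le: "u f \<le> z f" for f using \<open>u \<le> z\<close> by (simp add: le_fun_def)
  show h_le: "z h \<le> z (q * P + h)"
  proof (rule ccontr)
    assume less: "\<not> z h \<le> z (q * P + h)"
    \<comment> \<open>Cancellation under \<open>z\<close> forces equal values of
      \<open>q * P\<close> and \<open>h\<close>. But \<open>u\<close> is smaller on
      \<open>q * P\<close> and agrees with \<open>z\<close> on \<open>h\<close>, so under
      \<open>u\<close> nothing cancels and \<open>u (q * P + h) = z h\<close>, contrary to
      \<open>u \<le> z\<close>.\<close>
    have "z (q * P) = z h"
      using z.add_eq_right[of "q * P + h" "- h"] z.add_eq_left[of "q * P + h" "- h"] less
      by (simp add: z.uminus)
    then have "0 < z q * z P" using less z.nonneg[of "q * P + h"] by (simp add: z.mult)
    then have "0 < z q" using z.nonneg[of q] z.nonneg[of P] by (auto simp: zero_less_mult_iff)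
    have "u (q * P) \<le> z q * u P" using le u.nonneg by (simp add: u.mult mult_right_mono)
    also have "\<dots> < z q * z P" using \<open>0 < z q\<close> \<open>u P < z P\<close> by simp
    also have "\<dots> = u h" using \<open>z (q * P) = z h\<close> min[OF h] by (simp add: z.mult)
    finally have "u (q * P + h) = z h" using u.add_eq_right min[OF h] by simp
    then show False using le[of "q * P + h"] less by simp
  qed
  show "z (q * P) \<le> z (q * P + h)"
    using z.diff_ultrametric[of "q * P + h" h] h_le by simp
qed

text \<open>Norm equivalence gives \<open>w h \<le> D * z h\<close> in degrees below
  \<open>degree P\<close>, and division by \<open>P\<close> carries this with the same
  \<open>D\<close> to all polynomials. Applying it to \<open>f ^ n\<close> removes
  \<open>D\<close>.\<close>

lemma key_polynomial_le:
  assumes u: "u \<in> berkovich_line v" and z: "z \<in> berkovich_line v" and w: "w \<in> berkovich_line v"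
    and "u \<le> z" and uP: "u P < z P" and min: "\<And>f. degree f < degree P \<Longrightarrow> u f = z f"
    and wP: "w P \<le> z P"
  shows "w \<le> z"
proof -
  interpret u: nonarch_mult_seminorm u using u by (rule berkovich_lineD)
  interpret z: nonarch_mult_seminorm z using z by (rule berkovich_lineD)
  interpret w: nonarch_mult_seminorm w using w by (rule berkovich_lineD)
  \<comment> \<open>All points agree on constants.\<close>
  have P: "degree P \<noteq> 0"
  proof
    assume "degree P = 0"
    then obtain c where "P = [:c:]" by (rule degree_eq_zeroE)
    then show False using uP u z by (simp add: berkovich_line_const)
  qed
  have mod: "degree (f mod P) < degree P" for f
    using P degree_mod_less[of P f] by fastforce
  have deg_div: "degree (f div P) < degree f" if "f div P \<noteq> 0" for f
    using that P by (metis degree_div_less div_poly_less gr_zeroI)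
  have div: "z (f mod P) \<le> z f" "z (f div P) * z P \<le> z f" for f
    using key_polynomial_division[OF u z \<open>u \<le> z\<close> uP min mod[of f], of "f div P"]
    unfolding div_mult_mod_eq z.mult by simp_all
  \<comment> \<open>\<open>z\<close> is a norm: division by \<open>P\<close> shows that a kernel
    element \<open>f\<close> has degree below \<open>degree P\<close>, so \<open>u f = 0\<close> as
    well. Modulo a nonzero \<open>f\<close> both seminorms see only \<open>P mod f\<close>, on which
    they agree, contrary to \<open>u P < z P\<close>.\<close>
  have ker: "f = 0" if "z f = 0" for f
    using that
  proof (induction "degree f" arbitrary: f rule: less_induct)
    case less
    have "z (f div P) * z P \<le> 0" using div(2)[of f] less.prems by simp
    then have "z (f div P) = 0"
      using uP u.nonneg[of P] z.nonneg[of "f div P"] by (simp add: mult_le_0_iff)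
    then have "f div P = 0" using less.hyps deg_div by blast
    then have f: "degree f < degree P" using mod[of f] div_mult_mod_eq[of f P] by simp
    show ?case
    proof (rule ccontr)
      assume "f \<noteq> 0"
      have r: "degree (P mod f) < degree P"
        using degree_mod_less[OF \<open>f \<noteq> 0\<close>, of P] f P by auto
      have "u f = 0" using min[OF f] less.prems by simp
      have "z P \<le> z (P mod f)"
        using z.ultrametric[of "P div f * f" "P mod f"] less.prems z.nonneg[of "P mod f"]
        by (simp add: z.mult)
      also have "\<dots> = u (P mod f)" using min[OF r] by simp
      also have "\<dots> \<le> u P"
        using u.diff_ultrametric[of P "P div f * f"] \<open>u f = 0\<close> u.nonneg[of P]
        by (simp add: u.mult minus_div_mult_eq_mod)
      finally show False using uP by simp
    qed
  qed
  obtain C where "0 < C" and C: "\<And>h i. degree h < degree P \<Longrightarrow> v (coeff h i) \<le> C * z h"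
    using coeff_le_seminorm[OF z ker, of "degree P"] by (meson coeff_eq_0 less_le_trans)
  \<comment> \<open>\<open>B \<ge> 1\<close> makes \<open>B ^ degree P\<close> dominate all lower
    powers.\<close>
  define B where "B = max 1 (w [:0, 1:])"
  define D where "D = C * B ^ degree P"
  have B: "1 \<le> B" "w [:0, 1:] \<le> B" by (auto simp: B_def)
  have "0 < D" using \<open>0 < C\<close> B by (simp add: D_def)
  have low: "w h \<le> D * z h" if h: "degree h < degree P" for h
  proof -
    have "w (\<Sum>i\<le>degree h. monom (coeff h i) i) \<le> D * z h"
    proof (rule w.sum_le)
      fix i assume i: "i \<in> {..degree h}"
      have "w (monom (coeff h i) i) = v (coeff h i) * w [:0, 1:] ^ i"
        using w.mult[of "[:coeff h i:]" "[:0, 1:] ^ i"]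
        by (simp add: monom_altdef w.power berkovich_line_const[OF w])
      also have "\<dots> \<le> (C * z h) * B ^ i"
        using C[OF h] B w.nonneg \<open>0 < C\<close> z.nonneg by (intro mult_mono power_mono) auto
      also have "\<dots> \<le> (C * z h) * B ^ degree P"
        using B h i \<open>0 < C\<close> z.nonneg by (intro mult_left_mono power_increasing) auto
      finally show "w (monom (coeff h i) i) \<le> D * z h" by (simp add: D_def mult_ac)
    qed (use \<open>0 < D\<close> z.nonneg in auto)
    then show ?thesis by (simp add: poly_as_sum_of_monoms)
  qed
  \<comment> \<open>By the ultrametric inequality the constant does not grow from one division to
    the next.\<close>
  have bound: "w f \<le> D * z f" for f
  proof (induction "degree f" arbitrary: f rule: less_induct)
    case less
    have "w (f div P) \<le> D * z (f div P)" using less[of "f div P"] deg_div[of f] by fastforce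
    then have "w (f div P) * w P \<le> D * z (f div P) * z P"
      using wP w.nonneg z.nonneg \<open>0 < D\<close> by (intro mult_mono) auto
    also have "\<dots> \<le> D * z f" using div(2)[of f] \<open>0 < D\<close> by (simp add: mult.assoc)
    finally have "w (f div P * P) \<le> D * z f" by (simp add: w.mult)
    moreover have "w (f mod P) \<le> D * z f"
      using order_trans[OF low[OF mod] mult_left_mono[OF div(1)]] \<open>0 < D\<close> by simp
    ultimately show ?case
      using w.ultrametric[of "f div P * P" "f mod P"] by simp
  qed
  show "w \<le> z"
  proof (rule le_funI)
    fix f
    show "w f \<le> z f"
    proof (rule le_of_power_le_linear_mult_power[OF z.nonneg])
      fix n
      have "w f ^ n \<le> D * z f ^ n" using bound[of "f ^ n"] by (simp add: w.power z.power)
      also have "\<dots> \<le> D * (real n + 1) * z f ^ n"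
        using \<open>0 < D\<close> z.nonneg by (intro mult_right_mono) auto
      finally show "w f ^ n \<le> D * (real n + 1) * z f ^ n" .
    qed
  qed
qed

lemma ex_key_polynomial:
  assumes "u \<in> berkovich_line v" "z \<in> berkovich_line v" and "u < z"
  obtains P where "u P < z P" "\<And>f. degree f < degree P \<Longrightarrow> u f = z f"
proof -
  have le: "u f \<le> z f" for f using \<open>u < z\<close> by (simp add: less_le le_fun_def)
  have "\<exists>f. u f < z f"
    using \<open>u < z\<close> by (auto simp: less_fun_def le_fun_def not_le)
  then obtain P where "u P < z P" "\<And>f. u f < z f \<Longrightarrow> degree P \<le> degree f"
    using ex_has_least_nat[of "\<lambda>f. u f < z f" _ degree] by blast
  then show ?thesis using le that[of P] by (metis less_le not_le)
qed

section \<open>The points above a given point\<close>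

lemma closed_flow_le: "closed {t. flow u t \<le> z}"
proof -
  have "{t. flow u t \<le> z} = (\<Inter>P. {t. flow u t P \<le> z P})" by (auto simp: le_fun_def)
  then show ?thesis
    by (auto intro!: closed_Collect_le continuous_on_flow)
qed

lemma closed_le_flow: "closed {t. z \<le> flow u t}"
proof -
  have "{t. z \<le> flow u t} = (\<Inter>P. {t. z P \<le> flow u t P})" by (auto simp: le_fun_def)
  then show ?thesis
    by (auto intro!: closed_Collect_le continuous_on_flow)
qed

text \<open>The set of these times is closed by continuity, and bounded because the value at
  \<open>T\<close> is at least the time.\<close>

lemma ex_greatest_flow_le:
  assumes u: "u \<in> berkovich_line v" and "u \<le> z"
  obtains t where "0 \<le> t" "flow u t \<le> z" "\<And>s. 0 \<le> s \<Longrightarrow> flow u s \<le> z \<Longrightarrow> s \<le> t"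
proof -
  define S where "S = {0..} \<inter> {t. flow u t \<le> z}"
  have "0 \<in> S" using flow_0[OF u] \<open>u \<le> z\<close> by (simp add: S_def)
  have "t \<le> z [:0, 1:]" if "t \<in> S" for t
    using that order_trans[OF flow_unbounded[OF u]] by (auto simp: S_def le_fun_def)
  then have "bdd_above S" by (rule bdd_aboveI)
  have "closed S" unfolding S_def by (intro closed_Int closed_flow_le) auto
  then have "Sup S \<in> S"
    using closed_contains_Sup[OF _ \<open>bdd_above S\<close>] \<open>0 \<in> S\<close> by blast
  moreover have "s \<le> Sup S" if "0 \<le> s" "flow u s \<le> z" for s
    using that \<open>bdd_above S\<close> by (intro cSup_upper) (auto simp: S_def)
  ultimately show ?thesis using that by (auto simp: S_def)
qed

text \<open>The largest \<open>t\<close> with \<open>flow u t \<le> z\<close> gives equality: otherwise a key polynomial shows that the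
  flow stays below \<open>z\<close> a little longer.\<close>

lemma le_imp_flow:
  assumes u: "u \<in> berkovich_line v" and z: "z \<in> berkovich_line v" and "u \<le> z"
  obtains t where "0 \<le> t" "flow u t = z"
proof -
  obtain t where t: "0 \<le> t" "flow u t \<le> z" and greatest: "\<And>s. 0 \<le> s \<Longrightarrow> flow u s \<le> z \<Longrightarrow> s \<le> t"
    using ex_greatest_flow_le[OF u \<open>u \<le> z\<close>] by blast
  have ft: "flow u t \<in> berkovich_line v" using u t(1) by (rule flow_in_berkovich_line)
  have "flow u t = z"
  proof (rule ccontr)
    assume "flow u t \<noteq> z"
    with t have "flow u t < z" by simp
    then obtain P where P: "flow u t P < z P" "\<And>f. degree f < degree P \<Longrightarrow> flow u t f = z f"
      using ex_key_polynomial[OF ft z] by blast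
    have "open {s. flow u s P < z P}" by (intro open_Collect_less continuous_on_flow continuous_intros)
    then obtain e where "0 < e" and e: "\<And>s. dist s t < e \<Longrightarrow> flow u s P < z P"
      using P(1) unfolding open_dist by blast
    define s where "s = t + e / 2"
    have s: "t < s" "0 \<le> s" "dist s t < e" using \<open>0 < e\<close> t by (auto simp: s_def dist_real_def)
    \<comment> \<open>The pair \<open>flow u t < z\<close> provides the key polynomial, and the
      later \<open>flow u s\<close> is the third point that it compares with
      \<open>z\<close>.\<close>
    have "flow u s \<le> z"
      using key_polynomial_le[OF ft z flow_in_berkovich_line[OF u s(2)] t(2) P] e[OF s(3)] by simp
    then show False using greatest[OF s(2)] s(1) by simp
  qed
  then show ?thesis using t that by blast
qed

text \<open>Both points lie on the flow of \<open>u\<close>, which is monotone in time.\<close>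

lemma upper_set_chain:
  assumes "u \<in> berkovich_line v" "a \<in> berkovich_line v" "b \<in> berkovich_line v" "u \<le> a" "u \<le> b"
  shows "a \<le> b \<or> b \<le> a"
proof -
  obtain s where s: "0 \<le> s" "flow u s = a" using le_imp_flow[OF assms(1,2,4)] by blast
  obtain t where t: "0 \<le> t" "flow u t = b" using le_imp_flow[OF assms(1,3,5)] by blast
  show ?thesis using s t flow_mono[OF assms(1), of s t] flow_mono[OF assms(1), of t s] by fastforce
qed

text \<open>The bound is the flow of \<open>x\<close> at the first time it lies above
  \<open>y\<close>; any common upper bound is on that flow, at no earlier time.\<close>

lemma ex_lub:
  assumes x: "x \<in> berkovich_line v" and y: "y \<in> berkovich_line v"
  obtains z where "z \<in> berkovich_line v" "x \<le> z" "y \<le> z"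
    "\<And>w. w \<in> berkovich_line v \<Longrightarrow> x \<le> w \<Longrightarrow> y \<le> w \<Longrightarrow> z \<le> w"
proof -
  define S where "S = {0..} \<inter> {t. y \<le> flow x t}"
  have "closed S" unfolding S_def by (intro closed_Int closed_le_flow) auto
  have S: "t \<in> S" if "0 \<le> t" "y \<le> flow x t" for t using that by (auto simp: S_def)
  obtain w where "w \<in> berkovich_line v" "x \<le> w" "y \<le> w" using ex_upper_bound[OF x y] by blast
  then have "S \<noteq> {}" using le_imp_flow[OF x] S by (metis empty_iff)
  moreover have "bdd_below S" by (auto simp: S_def)
  ultimately have t: "Inf S \<in> S" using \<open>closed S\<close> by (intro closed_contains_Inf)
  show ?thesis
  proof (rule that)
    show "flow x (Inf S) \<in> berkovich_line v" "x \<le> flow x (Inf S)" "y \<le> flow x (Inf S)"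
      using t flow_in_berkovich_line[OF x] le_flow[OF x] by (auto simp: S_def)
  next
    fix w assume w: "w \<in> berkovich_line v" "x \<le> w" "y \<le> w"
    then obtain s where s: "0 \<le> s" "flow x s = w" using le_imp_flow[OF x] by blast
    then have "Inf S \<le> s" using w \<open>bdd_below S\<close> by (intro cInf_lower S) auto
    then show "flow x (Inf S) \<le> w" using s t flow_mono[OF x] by (auto simp: S_def)
  qed
qed

section \<open>Branches\<close>

text \<open>The downward direction at \<open>w\<close> that contains \<open>x\<close>; empty unless
  \<open>x < w\<close>.\<close>

definition branch :: "('a poly \<Rightarrow> real) \<Rightarrow> ('a poly \<Rightarrow> real) \<Rightarrow> ('a poly \<Rightarrow> real) set" where
  "branch x w = {a \<in> berkovich_line v. \<exists>u\<in>berkovich_line v. a \<le> u \<and> x \<le> u \<and> u < w}"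

lemma openin_eval_less: "openin (berkovich_topology v) {x \<in> berkovich_line v. x P < c}"
  using openin_continuous_map_preimage[OF continuous_map_berkovich_eval[of v P], of "{..<c}"] by simp

lemma openin_eval_greater: "openin (berkovich_topology v) {x \<in> berkovich_line v. c < x P}"
  using openin_continuous_map_preimage[OF continuous_map_berkovich_eval[of v P], of "{c<..}"] by simp

lemma Hausdorff_space_berkovich: "Hausdorff_space (berkovich_topology v)"
  unfolding Hausdorff_space_def
proof (intro allI impI)
  fix x y assume "x \<in> topspace (berkovich_topology v) \<and> y \<in> topspace (berkovich_topology v) \<and> x \<noteq> y"
  then obtain P where xy: "x \<in> berkovich_line v" "y \<in> berkovich_line v" and "x P \<noteq> y P" by auto
  obtain c where c: "x P < c \<and> c < y P \<or> y P < c \<and> c < x P"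
    using \<open>x P \<noteq> y P\<close> dense by (metis linorder_neqE)
  have *: "disjnt {x \<in> berkovich_line v. x P < c} {x \<in> berkovich_line v. c < x P}"
    by (auto simp: disjnt_def)
  show "\<exists>U V. openin (berkovich_topology v) U \<and> openin (berkovich_topology v) V \<and>
      x \<in> U \<and> y \<in> V \<and> disjnt U V"
    using c
  proof
    assume "x P < c \<and> c < y P"
    then show ?thesis using * xy openin_eval_less[of P c] openin_eval_greater[of c P] by blast
  next
    assume "y P < c \<and> c < x P"
    then show ?thesis
      using disjnt_sym[OF *] xy openin_eval_less[of P c] openin_eval_greater[of c P] by blast
  qed
qed

text \<open>If \<open>P\<close> is a key polynomial for \<open>u < w\<close>, then the whole open set where \<open>P\<close> is smaller than at
  \<open>w\<close> lies in the branch of \<open>u\<close>: flow \<open>u\<close> up to a point \<open>u'\<close> where \<open>P\<close> takes a value between those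
  at the given point and at \<open>w\<close>; then \<open>P\<close> is also a key polynomial for \<open>u < u'\<close>.\<close>

lemma openin_branch:
  assumes w: "w \<in> berkovich_line v"
  shows "openin (berkovich_topology v) (branch x w)"
  unfolding openin_subopen[of _ "branch x w"]
proof
  fix a assume "a \<in> branch x w"
  then obtain u where a: "a \<in> berkovich_line v" and u: "u \<in> berkovich_line v" "a \<le> u" "x \<le> u" "u < w"
    by (auto simp: branch_def)
  obtain P where P: "u P < w P" "\<And>f. degree f < degree P \<Longrightarrow> u f = w f"
    using ex_key_polynomial[OF u(1) w u(4)] by blast
  have "b \<in> branch x w" if b: "b \<in> berkovich_line v" "b P < w P" for b
  proof -
    \<comment> \<open>\<open>c > b P\<close> will give \<open>b \<le> u'\<close>, and
      \<open>c < w P\<close> will give \<open>u' < w\<close>.\<close>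
    obtain c where c: "u P < c" "b P < c" "c < w P" using P b dense by (metis max_less_iff_conj)
    obtain t0 where t0: "0 \<le> t0" "flow u t0 = w" using le_imp_flow[OF u(1) w less_imp_le[OF u(4)]] by blast
    have "\<exists>t\<ge>0. t \<le> t0 \<and> flow u t P = c"
      using t0 c flow_0[OF u(1)] by (intro IVT' continuous_on_flow) auto
    then obtain t where t: "0 \<le> t" "t \<le> t0" "flow u t P = c" by blast
    define u' where "u' = flow u t"
    have u': "u' \<in> berkovich_line v" "u \<le> u'" "u' \<le> w" "u' P = c"
      using t t0 flow_in_berkovich_line[OF u(1)] le_flow[OF u(1)] flow_mono[OF u(1), of t t0]
      by (auto simp: u'_def)
    \<comment> \<open>\<open>u'\<close> is squeezed between \<open>u\<close> and \<open>w\<close>,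
      which agree in these degrees.\<close>
    have "u f = u' f" if "degree f < degree P" for f
      using u'(2,3) P(2)[OF that] by (metis le_funD order_antisym)
    then have "b \<le> u'"
      using key_polynomial_le[OF u(1) u'(1) b(1) u'(2), of P] u'(4) c by simp
    moreover have "u' < w" using u' c by (metis less_le)
    ultimately show ?thesis using b u u' by (auto simp: branch_def intro: order_trans)
  qed
  moreover have "a P < w P" using u(2) P(1) by (metis le_funD le_less_trans)
  ultimately show "\<exists>T. openin (berkovich_topology v) T \<and> a \<in> T \<and> T \<subseteq> branch x w"
    using openin_eval_less[of P "w P"] a by (intro exI[of _ "{x \<in> berkovich_line v. x P < w P}"]) auto
qed

text \<open>The two witnesses both lie above \<open>a\<close>, hence are comparable, and the larger
  one serves \<open>x\<close> and \<open>y\<close> together. So branches at \<open>w\<close> that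
  share a point coincide.\<close>

lemma branch_eq:
  assumes "a \<in> branch x w" "a \<in> branch y w" and w: "w \<in> berkovich_line v"
    and y: "y \<in> berkovich_line v"
  shows "y \<in> branch x w"
proof -
  obtain u u' where "a \<in> berkovich_line v"
    "u \<in> berkovich_line v" "a \<le> u" "x \<le> u" "u < w"
    "u' \<in> berkovich_line v" "a \<le> u'" "y \<le> u'" "u' < w"
    using assms by (auto simp: branch_def)
  moreover from this have "u \<le> u' \<or> u' \<le> u" using upper_set_chain by blast
  ultimately show ?thesis using y by (auto simp: branch_def intro: order_trans)
qed

text \<open>Removing \<open>w\<close> leaves two disjoint open sets, the branch of \<open>x\<close>
  and the rest \<open>V\<close>, so a connected set meeting both contains \<open>w\<close>.\<close>

lemma mem_connected_of_branch:
  assumes K: "connectedin (berkovich_topology v) K" "x \<in> K" "y \<in> K"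
    and w: "w \<in> berkovich_line v" and "x \<le> w" "x \<noteq> w" and y: "y \<notin> branch x w"
  shows "w \<in> K"
proof (rule ccontr)
  assume "w \<notin> K"
  have KB: "K \<subseteq> berkovich_line v" using connectedin_subset_topspace[OF K(1)] by simp
  define V where "V = {a \<in> berkovich_line v. a \<noteq> w \<and> a \<notin> branch x w}"
  have self: "a \<in> branch a w" if "a \<in> berkovich_line v" "a < w" for a
    using that by (auto simp: branch_def)
  \<comment> \<open>Below \<open>w\<close>, \<open>V\<close> consists of whole branches, which are
    open; a point not below \<open>w\<close> exceeds it at some \<open>P\<close>, an open condition
    that no point of the branch satisfies.\<close>
  have "openin (berkovich_topology v) V"
    unfolding openin_subopen[of _ V]
  proof
    fix a assume a: "a \<in> V"
    show "\<exists>T. openin (berkovich_topology v) T \<and> a \<in> T \<and> T \<subseteq> V"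
    proof (cases "a \<le> w")
      case True
      have "branch a w \<subseteq> V"
      proof
        fix b assume b: "b \<in> branch a w"
        then have "b \<in> berkovich_line v" "b < w" by (auto simp: branch_def)
        moreover have "b \<notin> branch x w" using branch_eq[OF _ b w] a by (auto simp: V_def)
        ultimately show "b \<in> V" by (auto simp: V_def)
      qed
      moreover have "a \<in> branch a w" using self[of a] a True by (auto simp: V_def less_le)
      ultimately show ?thesis using openin_branch[OF w] by blast
    next
      case False
      then obtain P where P: "w P < a P" by (auto simp: le_fun_def not_le)
      have "{b \<in> berkovich_line v. w P < b P} \<subseteq> V"
      proof
        fix b assume b: "b \<in> {b \<in> berkovich_line v. w P < b P}"
        then have "\<not> b \<le> w" by (auto simp: le_fun_def not_le)
        then show "b \<in> V" using b by (auto simp: V_def branch_def less_le intro: order_trans)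
      qed
      then show ?thesis using openin_eval_greater[of "w P" P] P a by (auto simp: V_def)
    qed
  qed
  moreover have "K \<subseteq> branch x w \<union> V" using KB \<open>w \<notin> K\<close> by (auto simp: V_def)
  moreover have "x \<in> branch x w" using self assms KB by (simp add: less_le subset_iff)
  moreover have "y \<in> V" using K KB y \<open>w \<notin> K\<close> by (auto simp: V_def)
  moreover have "branch x w \<inter> V \<inter> K = {}" by (auto simp: V_def)
  ultimately show False using connectedinD[OF K(1) openin_branch[OF w, of x], of V] K by blast
qed

end

section \<open>Paths\<close>

text \<open>Both arcs end in the common point, so \<open>q\<close> is run backwards from
  \<open>d\<close> to \<open>c\<close>. They are glued on \<open>{0..L}\<close>, with
  \<open>L\<close> the total length, and then rescaled. One of the arcs may be a single
  point.\<close>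

lemma ex_injective_path_join:
  fixes p q :: "real \<Rightarrow> 'a"
  assumes p: "continuous_map (top_of_set {a..b}) X p" "inj_on p {a..b}" "a \<le> b"
    and q: "continuous_map (top_of_set {c..d}) X q" "inj_on q {c..d}" "c \<le> d"
    and meet: "p b = q d" "p ` {a..b} \<inter> q ` {c..d} \<subseteq> {p b}"
    and ne: "p a \<noteq> q c"
  obtains g where "pathin X g" "inj_on g {0..1}" "g 0 = p a" "g 1 = q c"
    "g ` {0..1} = p ` {a..b} \<union> q ` {c..d}"
proof -
  define m where "m = b - a"
  define L where "L = m + (d - c)"
  \<comment> \<open>The arcs are not both single points, as the outer ends differ.\<close>
  have "L \<noteq> 0"
  proof
    assume "L = 0"
    then have "a = b" "c = d" using p(3) q(3) by (auto simp: L_def m_def)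
    then show False using meet(1) ne by simp
  qed
  then have L: "0 < L" and m: "0 \<le> m" "m \<le> L" using p(3) q(3) by (auto simp: L_def m_def)
  define h where "h = (\<lambda>s. if s \<le> m then p (a + s) else q (d - (s - m)))"
  have h1: "h s = p (a + s)" "a + s \<in> {a..b}" if "0 \<le> s" "s \<le> m" for s
    using that by (auto simp: h_def m_def)
  have h2: "h s = q (d - (s - m))" "d - (s - m) \<in> {c..d}" if "m \<le> s" "s \<le> L" for s
    using that meet(1) by (auto simp: h_def m_def L_def)
  have inj_h: "inj_on h {0..L}"
  proof (rule linorder_inj_onI)
    fix s t assume st: "s < t" "s \<in> {0..L}" "t \<in> {0..L}"
    consider "t \<le> m" | "m \<le> s" | "s < m" "m < t" by linarith
    then show "h s \<noteq> h t"
    proof cases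
      case 1
      then show ?thesis using st h1[of s] h1[of t] inj_onD[OF p(2), of "a + s" "a + t"] by auto
    next
      case 2
      then show ?thesis
        using st h2[of s] h2[of t] inj_onD[OF q(2), of "d - (s - m)" "d - (t - m)"] by auto
    next
      \<comment> \<open>The arcs share only the value \<open>p b\<close>, which \<open>p\<close>
        takes only at \<open>b\<close>, that is at \<open>s = m\<close>.\<close>
      case 3
      show ?thesis
      proof
        assume "h s = h t"
        then have "p (a + s) \<in> p ` {a..b} \<inter> q ` {c..d}"
          using 3 st h1[of s] h2[of t] \<open>h s = h t\<close> by (metis IntI atLeastAtMost_iff imageI less_imp_le)
        then have "p (a + s) = p b" using meet(2) by blast
        then have "a + s = b" using 3 st h1[of s] p(3) by (intro inj_onD[OF p(2)]) auto
        then show False using 3 by (simp add: m_def)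
      qed
    qed
  qed auto
  define g where "g = (\<lambda>t. h (L * t))"
  have scale: "(\<lambda>t. L * t) ` {0..1} = {0..L}"
    using L by (simp add: image_mult_atLeastAtMost)
  show ?thesis
  proof (rule that)
    have "continuous_map (top_of_set {0..1}) X
      (\<lambda>t. if L * t \<le> m then p (a + L * t) else q (d - (L * t - m)))"
    proof (rule continuous_map_cases_le)
      show "continuous_map (subtopology (top_of_set {0..1}) {t \<in> topspace (top_of_set {0..1}). L * t \<le> m})
          X (\<lambda>t. p (a + L * t))"
      proof (rule continuous_map_compose[OF _ p(1), unfolded o_def])
        have "continuous_on {t. 0 \<le> t \<and> t \<le> 1 \<and> L * t \<le> m} (\<lambda>t. a + L * t)" by (intro continuous_intros)
        then show "continuous_map (subtopology (top_of_set {0..1}) {t \<in> topspace (top_of_set {0..1}). L * t \<le> m})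
          (top_of_set {a..b}) (\<lambda>t. a + L * t)"
          using L by (auto simp: continuous_map_in_subtopology subtopology_subtopology m_def
              Int_def conj_ac)
      qed
      show "continuous_map (subtopology (top_of_set {0..1}) {t \<in> topspace (top_of_set {0..1}). m \<le> L * t})
          X (\<lambda>t. q (d - (L * t - m)))"
      proof (rule continuous_map_compose[OF _ q(1), unfolded o_def])
        have "continuous_on {t. 0 \<le> t \<and> t \<le> 1 \<and> m \<le> L * t} (\<lambda>t. d - (L * t - m))"
          by (intro continuous_intros)
        moreover have "c \<le> d - (L * t - m)" if "t \<le> 1" for t
        proof -
          have "L * t \<le> L" using that L by simp
          then show ?thesis by (simp add: L_def)
        qed
        ultimately show "continuous_map (subtopology (top_of_set {0..1}) {t \<in> topspace (top_of_set {0..1}). m \<le> L * t})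
          (top_of_set {c..d}) (\<lambda>t. d - (L * t - m))"
          by (auto simp: continuous_map_in_subtopology subtopology_subtopology
              Int_def conj_ac)
      qed
      show "p (a + L * t) = q (d - (L * t - m))" if "L * t = m" for t
        using that meet(1) by (simp add: m_def)
    qed (auto intro!: continuous_intros)
    then show "pathin X g" by (simp add: pathin_def g_def h_def)
    have "inj_on (\<lambda>t. L * t) {0..1}" using L by (auto intro!: inj_onI)
    from comp_inj_on[OF this, of h] inj_h show "inj_on g {0..1}"
      unfolding scale g_def o_def by blast
    show "g 0 = p a" using h1[of 0] m by (simp add: g_def)
    show "g 1 = q c" using h2[of L] m by (simp add: g_def L_def)
    \<comment> \<open>The two pieces are the parameter intervals, moved to their places in
      \<open>{0..L}\<close>.\<close>
    have "{0..L} = (\<lambda>t. t - a) ` {a..b} \<union> (\<lambda>t. d - t + m) ` {c..d}"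
    proof (intro equalityI subsetI)
      fix s assume s: "s \<in> {0..L}"
      show "s \<in> (\<lambda>t. t - a) ` {a..b} \<union> (\<lambda>t. d - t + m) ` {c..d}"
      proof (cases "s \<le> m")
        case True
        then have "s = (a + s) - a" "a + s \<in> {a..b}" using s by (auto simp: m_def)
        then show ?thesis by blast
      next
        case False
        then have "s = d - (d - (s - m)) + m" "d - (s - m) \<in> {c..d}" using s by (auto simp: L_def)
        then show ?thesis by blast
      qed
    qed (use m p(3) q(3) in \<open>auto simp: L_def m_def\<close>)
    then have "h ` {0..L} = h ` ((\<lambda>t. t - a) ` {a..b} \<union> (\<lambda>t. d - t + m) ` {c..d})" by (rule arg_cong)
    also have "\<dots> = (\<lambda>t. h (t - a)) ` {a..b} \<union> (\<lambda>t. h (d - t + m)) ` {c..d}"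
      unfolding image_Un image_image ..
    also have "(\<lambda>t. h (t - a)) ` {a..b} = p ` {a..b}"
      using h1(1) by (intro image_cong) (auto simp: m_def)
    also have "(\<lambda>t. h (d - t + m)) ` {c..d} = q ` {c..d}"
      using h2(1) by (intro image_cong) (auto simp: L_def)
    finally show "g ` {0..1} = p ` {a..b} \<union> q ` {c..d}"
      using image_image[of h "\<lambda>t. L * t" "{0..1}"] by (simp add: scale g_def)
  qed
qed

text \<open>A point \<open>g t\<close> missing from \<open>C\<close> would split it: the images of
  \<open>{0..t}\<close> and \<open>{t..1}\<close> are compact, hence closed, and by injectivity meet
  only in \<open>g t\<close>.\<close>

lemma connected_subset_injective_path_image:
  assumes X: "Hausdorff_space X" and g: "pathin X g" "inj_on g {0..1}"
    and C: "connectedin X C" "g 0 \<in> C" "g 1 \<in> C" "C \<subseteq> g ` {0..1}"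
  shows "C = g ` {0..1}"
proof (rule equalityI[OF C(4)], rule ccontr)
  assume "\<not> g ` {0..1} \<subseteq> C"
  then obtain t where t: "t \<in> {0..1}" "g t \<notin> C" by blast
  have closed: "closedin X (g ` {a..b})" if "{a..b} \<subseteq> {0..1}" for a b
  proof -
    have "compactin (top_of_set {0..1}) {a..b}" using that by (simp add: compactin_subtopology)
    then show ?thesis
      using X g(1) by (auto simp: pathin_def intro: compactin_imp_closedin image_compactin)
  qed
  have "C \<subseteq> g ` {0..t} \<union> g ` {t..1}"
  proof
    fix w assume "w \<in> C"
    then obtain s where "s \<in> {0..1}" "w = g s" using C(4) by blast
    then show "w \<in> g ` {0..t} \<union> g ` {t..1}" by (cases "s \<le> t") auto
  qed
  moreover have "g ` {0..t} \<inter> g ` {t..1} \<inter> C = {}"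
  proof (rule ccontr)
    assume "\<not> ?thesis"
    then obtain w where w: "w \<in> g ` {0..t}" "w \<in> g ` {t..1}" "w \<in> C" by blast
    then obtain r s where rs: "r \<in> {0..t}" "s \<in> {t..1}" "g r = g s" "g r \<in> C" by (metis imageE)
    then have "r = s" using t by (intro inj_onD[OF g(2)]) auto
    then show False using rs t by auto
  qed
  moreover have "closedin X (g ` {0..t})" "closedin X (g ` {t..1})" using t by (auto intro!: closed)
  moreover have "g ` {0..t} \<inter> C \<noteq> {}" "g ` {t..1} \<inter> C \<noteq> {}" using C(2,3) t by force+
  ultimately show False using C(1) unfolding connectedin_closedin by blast
qed

section \<open>Segments of the flow and the path between two points\<close>

context nonarch_valued_field
begin

text \<open>It suffices to test the generating open sets, where it is the continuity of
  \<open>flow x t P\<close> in \<open>t\<close>.\<close>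

lemma continuous_map_flow:
  assumes x: "x \<in> berkovich_line v" and S: "S \<subseteq> {0..}"
  shows "continuous_map (top_of_set S) (berkovich_topology v) (flow x)"
  unfolding berkovich_topology_def
proof (rule continuous_on_generated_topo)
  have flow: "flow x t \<in> berkovich_line v" if "t \<in> S" for t
    using that S flow_in_berkovich_line[OF x, of t] by auto
  show "flow x ` topspace (top_of_set S) \<subseteq> \<Union> {{x \<in> berkovich_line v. x P \<in> U} |P U. open U}"
    using flow topspace_berkovich_topology[of v]
    unfolding berkovich_topology_def topology_generated_by_topspace by auto
  fix W assume "W \<in> {{x \<in> berkovich_line v. x P \<in> U} |P U. open U}"
  then obtain P U where W: "W = {x \<in> berkovich_line v. x P \<in> U}" "open U" by blast
  have "flow x -` W \<inter> topspace (top_of_set S) = S \<inter> (\<lambda>t. flow x t P) -` U"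
    using flow W by auto
  then show "openin (top_of_set S) (flow x -` W \<inter> topspace (top_of_set S))"
    using continuous_openin_preimage_gen[OF continuous_on_flow W(2)] by simp
qed

end

context complete_nonarch_valued_field
begin

text \<open>The flow may rest at \<open>x\<close> first; \<open>a\<close> is the last time there,
  and from then on the flow is injective.\<close>

lemma ex_flow_interval:
  assumes x: "x \<in> berkovich_line v" and z: "z \<in> berkovich_line v" and "x \<le> z"
  obtains a b where "0 \<le> a" "a \<le> b" "flow x a = x" "flow x b = z" "inj_on (flow x) {a..b}"
    "flow x ` {a..b} = {w \<in> berkovich_line v. x \<le> w \<and> w \<le> z}"
proof -
  obtain a where a: "0 \<le> a" "flow x a \<le> x" and greatest: "\<And>s. 0 \<le> s \<Longrightarrow> flow x s \<le> x \<Longrightarrow> s \<le> a"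
    using ex_greatest_flow_le[OF x order_refl] by blast
  have xa: "flow x a = x" using a le_flow[OF x a(1)] by (intro antisym)
  obtain t where t: "0 \<le> t" "flow x t = z" using le_imp_flow[OF x z \<open>x \<le> z\<close>] by blast
  \<comment> \<open>\<open>z\<close> can be reached before \<open>a\<close> only if
    \<open>z = x\<close>.\<close>
  define b where "b = max a t"
  have xb: "flow x b = z"
  proof (cases "a \<le> t")
    case False
    then have "z \<le> x" using flow_mono[OF x t(1), of a] xa t(2) by simp
    then show ?thesis using False xa \<open>x \<le> z\<close> by (simp add: b_def)
  qed (simp add: b_def t)
  have ab: "a \<le> b" "0 \<le> b" using a by (auto simp: b_def)
  show ?thesis
  proof (rule that[OF a(1) ab(1) xa xb])
    show "inj_on (flow x) {a..b}"
    proof (rule linorder_inj_onI)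
      fix s r assume sr: "s < r" "s \<in> {a..b}" "r \<in> {a..b}"
      show "flow x s \<noteq> flow x r"
      proof
        assume eq: "flow x s = flow x r"
        then have "flow x r = x" using flow_eq_imp_eq_start[OF x _ sr(1) eq] sr a by auto
        then have "r \<le> a" using greatest[of r] sr a by auto
        then show False using sr by auto
      qed
    qed auto
    show "flow x ` {a..b} = {w \<in> berkovich_line v. x \<le> w \<and> w \<le> z}"
    proof (intro equalityI subsetI)
      fix w assume "w \<in> flow x ` {a..b}"
      then obtain s where s: "a \<le> s" "s \<le> b" "w = flow x s" by auto
      then show "w \<in> {w \<in> berkovich_line v. x \<le> w \<and> w \<le> z}"
        using a flow_in_berkovich_line[OF x, of s] le_flow[OF x, of s] flow_mono[OF x, of s b] xb by auto
    next
      fix w assume w: "w \<in> {w \<in> berkovich_line v. x \<le> w \<and> w \<le> z}"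
      then obtain s where s: "0 \<le> s" "flow x s = w" using le_imp_flow[OF x] by blast
      consider "s < a" | "b < s" | "s \<in> {a..b}" by fastforce
      then show "w \<in> flow x ` {a..b}"
      proof cases
        case 1
        then have "w \<le> x" using flow_mono[OF x s(1), of a] xa s by simp
        then have "w = flow x a" using w xa by simp
        then show ?thesis using ab by simp
      next
        case 2
        then have "z \<le> w" using flow_mono[OF x ab(2), of s] xb s by simp
        then have "w = flow x b" using w xb by simp
        then show ?thesis using ab by simp
      qed (use s in blast)
    qed
  qed
qed

text \<open>The last clause, minimality among connected sets, is what uniqueness rests on.\<close>

lemma ex_injective_path:
  assumes x: "x \<in> berkovich_line v" and y: "y \<in> berkovich_line v" and "x \<noteq> y"
  obtains g where "pathin (berkovich_topology v) g" "inj_on g {0..1}" "g 0 = x" "g 1 = y"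
    "\<And>K. connectedin (berkovich_topology v) K \<Longrightarrow> x \<in> K \<Longrightarrow> y \<in> K \<Longrightarrow> g ` {0..1} \<subseteq> K"
proof -
  obtain z where z: "z \<in> berkovich_line v" "x \<le> z" "y \<le> z"
    and least: "\<And>w. w \<in> berkovich_line v \<Longrightarrow> x \<le> w \<Longrightarrow> y \<le> w \<Longrightarrow> z \<le> w"
    using ex_lub[OF x y] by blast
  obtain a b where ab: "0 \<le> a" "a \<le> b" "flow x a = x" "flow x b = z" "inj_on (flow x) {a..b}"
    "flow x ` {a..b} = {w \<in> berkovich_line v. x \<le> w \<and> w \<le> z}"
    using ex_flow_interval[OF x z(1,2)] by blast
  obtain c d where cd: "0 \<le> c" "c \<le> d" "flow y c = y" "flow y d = z" "inj_on (flow y) {c..d}"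
    "flow y ` {c..d} = {w \<in> berkovich_line v. y \<le> w \<and> w \<le> z}"
    using ex_flow_interval[OF y z(1,3)] by blast
  \<comment> \<open>A common point is an upper bound of \<open>x\<close> and \<open>y\<close> below
    \<open>z\<close>, hence equal to \<open>z\<close>.\<close>
  have "flow x ` {a..b} \<inter> flow y ` {c..d} \<subseteq> {flow x b}"
    unfolding ab cd using least by (auto intro: antisym)
  then obtain g where g: "pathin (berkovich_topology v) g" "inj_on g {0..1}" "g 0 = x" "g 1 = y"
    "g ` {0..1} = flow x ` {a..b} \<union> flow y ` {c..d}"
    using ex_injective_path_join[of a b "berkovich_topology v" "flow x" c d "flow y"]
      continuous_map_flow[OF x, of "{a..b}"] continuous_map_flow[OF y, of "{c..d}"] ab cd \<open>x \<noteq> y\<close> by auto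
  \<comment> \<open>Otherwise \<open>x\<close> and \<open>y\<close> would have a common upper bound
    strictly below \<open>w\<close>, hence below \<open>z\<close>. The unordered pair lets this
    serve both segments.\<close>
  have not_branch: "z' \<notin> branch x' w" if wz: "w \<le> z" and xy: "{x', z'} = {x, y}" for w x' z'
  proof
    assume "z' \<in> branch x' w"
    then obtain u where u: "u \<in> berkovich_line v" "x \<le> u" "y \<le> u" "u < w"
      using xy by (auto simp: branch_def doubleton_eq_iff)
    then have "z \<le> u" using least by blast
    then show False using u(4) wz by (meson leD le_less_trans order_trans)
  qed
  show ?thesis
  proof (rule that[OF g(1-4)])
    fix K assume K: "connectedin (berkovich_topology v) K" "x \<in> K" "y \<in> K"
    show "g ` {0..1} \<subseteq> K"
    proof
      fix w assume "w \<in> g ` {0..1}"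
      then consider "w \<in> berkovich_line v" "x \<le> w" "w \<le> z" | "w \<in> berkovich_line v" "y \<le> w" "w \<le> z"
        unfolding g(5) ab(6) cd(6) by blast
      then show "w \<in> K"
      proof cases
        case 1
        then show ?thesis
          using K not_branch[of w x y] mem_connected_of_branch[OF K] by (cases "w = x") auto
      next
        case 2
        then show ?thesis
          using K not_branch[of w y x] mem_connected_of_branch[OF K(1,3,2)] by (cases "w = y") auto
      qed
    qed
  qed
qed

end

theorem proposition6p12:
  fixes v :: "'k::field \<Rightarrow> real"
    and x y :: "'k poly \<Rightarrow> real"
  assumes "complete_nonarch_valued_field v"
    and "x \<in> berkovich_line v" and "y \<in> berkovich_line v"
  shows "\<exists>!I. I \<in> injective_paths (berkovich_topology v) x y"
proof -
  interpret complete_nonarch_valued_field v by (rule assms(1))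
  let ?X = "berkovich_topology v"
  show ?thesis
  proof (cases "x = y")
    case True
    have const: "{x} = (\<lambda>_. x) ` {0..1::real}" by (subst image_constant_conv) simp
    have "injective_path_from_to ?X x y (\<lambda>_. x)"
      using assms(2) True by (simp add: injective_path_from_to_def)
    with const have "{x} \<in> injective_paths ?X x y"
      unfolding injective_paths_def by blast
    moreover have "I = {x}" if I: "I \<in> injective_paths ?X x y" for I
    proof -
      obtain g where g: "I = g ` {0..1}" "injective_path_from_to ?X x y g"
        using I by (auto simp: injective_paths_def)
      \<comment> \<open>Equal ends rule out injectivity, so only the constant path is left.\<close>
      then have "g 0 = g 1" using True by (simp add: injective_path_from_to_def)
      then have "\<not> inj_on g {0..1}" using inj_onD[of g "{0..1}" 0 1] by auto
      then have "\<forall>t\<in>{0..1}. g t = x" using g(2) by (simp add: injective_path_from_to_def)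
      then show ?thesis unfolding g(1) const by (intro image_cong) auto
    qed
    ultimately show ?thesis by blast
  next
    case False
    obtain g where g: "pathin ?X g" "inj_on g {0..1}" "g 0 = x" "g 1 = y"
      and minimal: "\<And>K. connectedin ?X K \<Longrightarrow> x \<in> K \<Longrightarrow> y \<in> K \<Longrightarrow> g ` {0..1} \<subseteq> K"
      using ex_injective_path[OF assms(2,3) False] by metis
    have "g ` {0..1} \<in> injective_paths ?X x y"
      using g by (auto simp: injective_paths_def injective_path_from_to_def)
    moreover have "I = g ` {0..1}" if I: "I \<in> injective_paths ?X x y" for I
    proof -
      obtain f where f: "I = f ` {0..1}" "pathin ?X f" "f 0 = x" "f 1 = y"
        "inj_on f {0..1} \<or> (\<forall>t\<in>{0..1}. f t = x)"
        using I by (auto simp: injective_paths_def injective_path_from_to_def)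
      have "f 1 \<noteq> x" using f(4) False by simp
      then have inj: "inj_on f {0..1}" using f(5) by (metis atLeastAtMost_iff order_refl zero_le_one)
      have "x \<in> f ` {0..1}" "y \<in> f ` {0..1}" "x \<in> g ` {0..1}" "y \<in> g ` {0..1}"
        using f(3,4) g(3,4) by (auto intro: image_eqI[of _ _ 0] image_eqI[of _ _ 1])
      \<comment> \<open>By minimality the image of \<open>g\<close> lies in that of
        \<open>f\<close>; being connected and containing both ends, it is all of it.\<close>
      then show ?thesis
        using connected_subset_injective_path_image[OF Hausdorff_space_berkovich f(2) inj, of "g ` {0..1}"]
          connectedin_path_image[OF g(1)] minimal[OF connectedin_path_image[OF f(2)]] f by simp
    qed
    ultimately show ?thesis by blast
  qed
qed

end
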